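(* Let $\pi$ be a joint probability distribution of $(x,z)\in\mathcal{X}\times\mathcal{Z}$, with marginal $\gamma$ on $\mathcal{Z}$ and conditional distributions $\rho(\cdot|z)$ on $\mathcal{X}$, $z \in \mathcal{Z}$, so that $\pi(dx,dz)=\rho(dx|z)\,\gamma(dz)$. Let $c(x,y)$ be a pairwise cost function on $\mathcal{X}\times\mathcal{X}$. Consider the following two problems. (1) Extended Wasserstein barycenter problem: minimize $$C_K=\mathbb{E}_{z\sim\gamma}\Big[\mathbb{E}_{(x,y)\sim\xi_z}[c(x,y)]\Big]$$ over probability distributions $\mu$ on $\mathcal{X}$ and families of couplings $(\xi_z)_{z\in\mathcal{Z}}$ with $\xi_z\in\Pi(\rho(\cdot|z),\mu)$ for all $z$. (2) Monge barycenter problem: minimize $$C_M=\mathbb{E}_{(x,z)\sim\pi}[c(x,T(x,z))]$$ over maps $T:\mathcal{X}\times\mathcal{Z}\to\mathcal{X}$ such that the random variable $y=T(x,z)$, with $(x,z)\sim\pi$, is independent of $z$. Suppose that $(\mu^*,(\xi_z^* )_z)$ is a minimizer of problem (1) whose couplings are supported on maps, i.e. there are maps $Q_z:\mathcal{X}\to\mathcal{X}$ such that $\xi_z^*(dx,dy)=\rho(dx|z)\,\delta_{Q_z(x)}(dy)$ for all $z$. Then $T^*(x,z)=Q_z(x)$ is a minimizer of problem (2). Consequently the optimal values of the two problems coincide, $C_M=C_K$, and $\mu^*=T^*(\cdot,z)\#\rho(\cdot|z)$ for all $z$.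
   Context: $\Pi(\rho,\mu)$ denotes the set of joint probability distributions on $\mathcal{X}\times\mathcal{X}$ with first marginal $\rho$ and second marginal $\mu$; $\#$ denotes push-forward of measures. The factor space $\mathcal{Z}$ may have both continuous and discrete components (it need not be finite or discrete). The cost $c$ is nonnegative and measurable; the canonical example is $c(x,y)=\frac12\|y-x\|^2$. The usual measurability conventions are in force: $\mathcal{X}$ and $\mathcal{Z}$ are standard Borel spaces, a fixed version of the conditional distributions $\rho(\cdot|z)$ is used, $z\mapsto\xi_z$ is a measurable family (a probability kernel), the maps $T$ are measurable, and $(x,z)\mapsto Q_z(x)$ is measurable. *)

theory Defs
  imports "HOL-Probability.Probability"
begin

definition standard_borel :: "'a measure \<Rightarrow> bool" where
  "standard_borel M \<longleftrightarrow>
    (\<exists>T. completely_metrizable_space T \<and> second_countable T \<and>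
         space M = topspace T \<and> sets M = sigma_sets (topspace T) {U. openin T U})"

definition couplings :: "'a measure \<Rightarrow> 'b measure \<Rightarrow> ('a \<times> 'b) measure set" where
  "couplings \<rho> \<mu> = {\<xi> \<in> space (prob_algebra (\<rho> \<Otimes>\<^sub>M \<mu>)). distr \<xi> \<rho> fst = \<rho> \<and> distr \<xi> \<mu> snd = \<mu>}"

(* The library's indep_var forces both random variables to have the same value type;
   this is its characterization indep_var_eq without that restriction. *)
definition independent_rv ::
  "'a measure \<Rightarrow> 'b measure \<Rightarrow> ('a \<Rightarrow> 'b) \<Rightarrow> 'c measure \<Rightarrow> ('a \<Rightarrow> 'c) \<Rightarrow> bool" where
  "independent_rv M N Y K W \<longleftrightarrow>
    Y \<in> M \<rightarrow>\<^sub>M N \<and> W \<in> M \<rightarrow>\<^sub>M K \<and>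
    prob_space.indep_set M
      (sigma_sets (space M) {Y -` A \<inter> space M | A. A \<in> sets N})
      (sigma_sets (space M) {W -` B \<inter> space M | B. B \<in> sets K})"

(* X and Z are measurable spaces: only their carriers and sigma-algebras matter.
   Expectations of the nonnegative cost are nn_integrals, so they may be infinite. *)

definition barycenter_feasible ::
  "'x measure \<Rightarrow> 'z measure \<Rightarrow> ('z \<Rightarrow> 'x measure) \<Rightarrow>
    ('x measure \<times> ('z \<Rightarrow> ('x \<times> 'x) measure)) set" where
  "barycenter_feasible X Z \<rho> =
    {(\<mu>, \<xi>). \<mu> \<in> space (prob_algebra X) \<and> \<xi> \<in> Z \<rightarrow>\<^sub>M prob_algebra (X \<Otimes>\<^sub>M X) \<and>
             (\<forall>z\<in>space Z. \<xi> z \<in> couplings (\<rho> z) \<mu>)}"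

definition barycenter_cost ::
  "('x \<Rightarrow> 'x \<Rightarrow> real) \<Rightarrow> 'z measure \<Rightarrow>
    'x measure \<times> ('z \<Rightarrow> ('x \<times> 'x) measure) \<Rightarrow> ennreal" where
  "barycenter_cost c \<gamma> = (\<lambda>(\<mu>, \<xi>). \<integral>\<^sup>+ z. (\<integral>\<^sup>+ (x, y). ennreal (c x y) \<partial>\<xi> z) \<partial>\<gamma>)"

definition monge_feasible ::
  "'x measure \<Rightarrow> 'z measure \<Rightarrow> ('x \<times> 'z) measure \<Rightarrow> ('x \<times> 'z \<Rightarrow> 'x) set" where
  "monge_feasible X Z \<pi> =
    {T. T \<in> X \<Otimes>\<^sub>M Z \<rightarrow>\<^sub>M X \<and> independent_rv \<pi> X T Z snd}"

definition monge_cost ::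
  "('x \<Rightarrow> 'x \<Rightarrow> real) \<Rightarrow> ('x \<times> 'z) measure \<Rightarrow> ('x \<times> 'z \<Rightarrow> 'x) \<Rightarrow> ennreal" where
  "monge_cost c \<pi> T = (\<integral>\<^sup>+ (x, z). ennreal (c x (T (x, z))) \<partial>\<pi>)"

end

theory Submission
  imports Defs
begin

text \<open>
  A coupling supported on maps \<open>Q z\<close> transports every \<open>\<rho> z\<close> to the same \<open>\<mu>s\<close>, so
  \<open>T (x, z) = Q z x\<close> is independent of \<open>z\<close> and has the cost of that coupling. Conversely, let
  \<open>S\<close> be admissible for the Monge problem and let \<open>\<mu>\<close> be the law of \<open>S\<close>. Independence gives, for each
  measurable set, equality of its measures under \<open>S (\<cdot>, z) # \<rho> z\<close> and \<open>\<mu>\<close> for almost every \<open>z\<close>;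
  as \<open>X\<close> is countably generated, one null set serves all measurable sets. Off this null set
  take the coupling induced by \<open>S\<close>, on it the product coupling; the result is admissible for
  the barycenter problem and has the same cost as \<open>S\<close>.
\<close>

section \<open>Countable generation of standard Borel spaces\<close>

text \<open>A countable base, closed under finite intersections, is still countable. The closure is
  what later lets equality of two probability measures be tested on countably many sets.\<close>

lemma standard_borel_countable_generator:
  assumes "standard_borel M"
  obtains E where "countable E" "Int_stable E" "E \<subseteq> Pow (space M)" "space M \<in> E"
    "sets M = sigma_sets (space M) E"
proof -
  obtain T where T: "second_countable T" "space M = topspace T"
    "sets M = sigma_sets (topspace T) {U. openin T U}"
    using assms unfolding standard_borel_def by blast
  obtain B where B: "countable B" "\<And>V. V \<in> B \<Longrightarrow> openin T V"
    "\<And>U x. openin T U \<Longrightarrow> x \<in> U \<Longrightarrow> \<exists>V\<in>B. x \<in> V \<and> V \<subseteq> U"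
    using T(1) unfolding second_countable_def by metis
  \<comment> \<open>The factor \<open>topspace T\<close> keeps the empty intersection from being
    \<open>UNIV\<close>: \<open>F = {}\<close> yields the whole space.\<close>
  define E where "E = (\<lambda>F. topspace T \<inter> \<Inter>F) ` {F. finite F \<and> F \<subseteq> B}"
  have open_E: "openin T U" if U: "U \<in> E" for U
  proof -
    obtain F where F: "finite F" "F \<subseteq> B" "U = topspace T \<inter> \<Inter>F"
      using U unfolding E_def by blast
    have "openin T (\<Inter>(insert (topspace T) F))"
      using F B(2) by (intro openin_Inter) auto
    then show ?thesis using F(3) by simp
  qed
  have B_E: "V \<in> E" if "V \<in> B" for V
    unfolding E_def using that openin_subset[OF B(2)[OF that]]
    by (intro image_eqI[of _ _ "{V}"]) auto
  show ?thesis
  proof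
    show "countable E"
      unfolding E_def using B(1) by (intro countable_image countable_Collect_finite_subset)
    show "Int_stable E"
    proof (rule Int_stableI)
      fix a b assume "a \<in> E" and b: "b \<in> E"
      then obtain F where F: "finite F" "F \<subseteq> B" "a = topspace T \<inter> \<Inter>F"
        unfolding E_def by blast
      obtain G where G: "finite G" "G \<subseteq> B" "b = topspace T \<inter> \<Inter>G"
        using b unfolding E_def by blast
      have "a \<inter> b = topspace T \<inter> \<Inter>(F \<union> G)" using F(3) G(3) by auto
      then show "a \<inter> b \<in> E"
        unfolding E_def using F(1,2) G(1,2) by (intro image_eqI[of _ _ "F \<union> G"]) auto
    qed
    show E_Pow: "E \<subseteq> Pow (space M)"
      using open_E openin_subset T(2) by blast
    show "space M \<in> E"
      unfolding E_def T(2) by (intro image_eqI[of _ _ "{}"]) auto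
    show "sets M = sigma_sets (space M) E"
      unfolding T
    proof (rule sigma_sets_eqI)
      fix U assume "U \<in> {U. openin T U}"
      \<comment> \<open>An open set is the union of the base sets inside it, and this union is
        countable.\<close>
      then have U: "U = \<Union>{V \<in> B. V \<subseteq> U}" using B(3) by blast
      have "\<Union>{V \<in> B. V \<subseteq> U} \<in> sigma_sets (topspace T) E"
        using B(1) B_E by (intro sigma_sets_UNION) (auto intro: sigma_sets.Basic)
      then show "U \<in> sigma_sets (topspace T) E" using U by simp
    qed (use open_E in \<open>auto intro: sigma_sets.Basic\<close>)
  qed
qed

section \<open>Independence as a product rule for preimages\<close>

lemma Int_stable_vimage: "Int_stable {Y -` A \<inter> \<Omega> | A. A \<in> sets N}"
proof (rule Int_stableI)
  fix a b assume "a \<in> {Y -` A \<inter> \<Omega> | A. A \<in> sets N}" "b \<in> {Y -` A \<inter> \<Omega> | A. A \<in> sets N}"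
  then obtain A B where AB: "A \<in> sets N" "B \<in> sets N" "a = Y -` A \<inter> \<Omega>" "b = Y -` B \<inter> \<Omega>"
    by auto
  have "a \<inter> b = Y -` (A \<inter> B) \<inter> \<Omega>" using AB by auto
  then show "a \<inter> b \<in> {Y -` A \<inter> \<Omega> | A. A \<in> sets N}" using AB by blast
qed

text \<open>The preimages of measurable sets form intersection-stable families, so the product rule
  passes to the sigma-algebras they generate.\<close>

lemma independent_rv_iff:
  assumes "prob_space M" and Y: "Y \<in> M \<rightarrow>\<^sub>M N" and W: "W \<in> M \<rightarrow>\<^sub>M K"
  shows "independent_rv M N Y K W \<longleftrightarrow>
    (\<forall>A\<in>sets N. \<forall>B\<in>sets K. measure M (Y -` A \<inter> space M \<inter> (W -` B \<inter> space M)) =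
       measure M (Y -` A \<inter> space M) * measure M (W -` B \<inter> space M))"
    (is "_ \<longleftrightarrow> ?R")
proof -
  interpret prob_space M by fact
  show ?thesis
  proof
    assume "independent_rv M N Y K W"
    then have "indep_set (sigma_sets (space M) {Y -` A \<inter> space M | A. A \<in> sets N})
        (sigma_sets (space M) {W -` B \<inter> space M | B. B \<in> sets K})"
      by (simp add: independent_rv_def)
    then show ?R
      by (intro ballI indep_setD) (auto intro: sigma_sets.Basic)
  next
    assume ?R
    then have "indep_set {Y -` A \<inter> space M | A. A \<in> sets N} {W -` B \<inter> space M | B. B \<in> sets K}"
      using Y W by (intro indep_setI) auto
    then show "independent_rv M N Y K W"
      unfolding independent_rv_def using Y W
      by (intro conjI indep_set_sigma_sets Int_stable_vimage) simp_all
  qed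
qed

section \<open>Integration and cost through the disintegration of \<open>\<pi>\<close>\<close>

locale disintegration =
  fixes X :: "'x measure" and Z :: "'z measure" and \<pi> :: "('x \<times> 'z) measure"
    and \<gamma> :: "'z measure" and \<rho> :: "'z \<Rightarrow> 'x measure"
  assumes \<pi>_prob: "\<pi> \<in> space (prob_algebra (X \<Otimes>\<^sub>M Z))"
    and \<gamma>_eq: "\<gamma> = distr \<pi> Z snd"
    and \<rho>_kernel [measurable]: "\<rho> \<in> Z \<rightarrow>\<^sub>M prob_algebra X"
    and \<pi>_eq: "\<pi> = do {z \<leftarrow> \<gamma>; x \<leftarrow> \<rho> z; return (X \<Otimes>\<^sub>M Z) (x, z)}"
begin

lemma prob_space_\<pi>: "prob_space \<pi>" and sets_\<pi> [measurable_cong]: "sets \<pi> = sets (X \<Otimes>\<^sub>M Z)"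
  using \<pi>_prob by (auto simp: space_prob_algebra)

lemma space_\<pi>: "space \<pi> = space X \<times> space Z"
  using sets_eq_imp_space_eq[OF sets_\<pi>] by (simp add: space_pair_measure)

lemma snd_measurable_\<pi>: "snd \<in> \<pi> \<rightarrow>\<^sub>M Z"
  by measurable

lemma sets_\<gamma> [measurable_cong]: "sets \<gamma> = sets Z" and space_\<gamma>: "space \<gamma> = space Z"
  by (simp_all add: \<gamma>_eq)

lemma prob_space_\<gamma>: "prob_space \<gamma>"
  unfolding \<gamma>_eq by (rule prob_space.prob_space_distr[OF prob_space_\<pi> snd_measurable_\<pi>])

lemma \<rho>_prob: "z \<in> space Z \<Longrightarrow> prob_space (\<rho> z)"
  and sets_\<rho>: "z \<in> space Z \<Longrightarrow> sets (\<rho> z) = sets X"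
  using measurable_space[OF \<rho>_kernel] by (auto simp: space_prob_algebra)

lemma space_\<rho>: "z \<in> space Z \<Longrightarrow> space (\<rho> z) = space X"
  using sets_\<rho> by (rule sets_eq_imp_space_eq)

lemma section_measurable:
  assumes "S \<in> X \<Otimes>\<^sub>M Z \<rightarrow>\<^sub>M L" and "z \<in> space Z"
  shows "(\<lambda>x. S (x, z)) \<in> \<rho> z \<rightarrow>\<^sub>M L"
proof -
  have "(\<lambda>x. (x, z)) \<in> \<rho> z \<rightarrow>\<^sub>M X \<Otimes>\<^sub>M Z"
    using assms(2) by (subst measurable_cong_sets[OF sets_\<rho>[OF assms(2)] refl]) simp
  then show ?thesis
    using assms(1) by (rule measurable_compose)
qed

lemma nn_integral_\<pi>:
  assumes f [measurable]: "f \<in> borel_measurable (X \<Otimes>\<^sub>M Z)"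
  shows "(\<integral>\<^sup>+ p. f p \<partial>\<pi>) = (\<integral>\<^sup>+ z. \<integral>\<^sup>+ x. f (x, z) \<partial>\<rho> z \<partial>\<gamma>)"
proof -
  \<comment> \<open>\<open>?K z\<close> is \<open>\<rho> z\<close> placed on the fibre over
    \<open>z\<close>. The inner bind with \<open>return\<close> collapses to this push-forward, so
    the integral formula for a single bind applies.\<close>
  let ?K = "\<lambda>z. distr (\<rho> z) (X \<Otimes>\<^sub>M Z) (\<lambda>x. (x, z))"
  have K: "?K \<in> \<gamma> \<rightarrow>\<^sub>M prob_algebra (X \<Otimes>\<^sub>M Z)"
    by measurable
  have "\<pi> = \<gamma> \<bind> ?K"
    by (subst \<pi>_eq, intro bind_cong refl bind_return_distr')
       (auto simp: space_\<gamma> intro!: prob_space.not_empty[OF \<rho>_prob] section_measurable)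
  then have "(\<integral>\<^sup>+ p. f p \<partial>\<pi>) = (\<integral>\<^sup>+ z. \<integral>\<^sup>+ p. f p \<partial>?K z \<partial>\<gamma>)"
    using nn_integral_bind[OF f measurable_prob_algebraD[OF K]] by simp
  also have "\<dots> = (\<integral>\<^sup>+ z. \<integral>\<^sup>+ x. f (x, z) \<partial>\<rho> z \<partial>\<gamma>)"
    by (intro nn_integral_cong nn_integral_distr) (auto simp: space_\<gamma> intro!: section_measurable)
  finally show ?thesis .
qed

text \<open>Fubini along the disintegration: the second event only sees \<open>z\<close> and leaves
  the inner integral as a factor. Both implications between independence and push-forwards that do
  not vary with \<open>z\<close> are read off from this formula.\<close>

lemma emeasure_joint:
  assumes S [measurable]: "S \<in> X \<Otimes>\<^sub>M Z \<rightarrow>\<^sub>M X" and A [measurable]: "A \<in> sets X"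
    and B [measurable]: "B \<in> sets Z"
  shows "emeasure \<pi> (S -` A \<inter> space \<pi> \<inter> (snd -` B \<inter> space \<pi>)) =
    (\<integral>\<^sup>+ z. emeasure (distr (\<rho> z) X (\<lambda>x. S (x, z))) A * indicator B z \<partial>\<gamma>)"
proof -
  have m: "S -` A \<inter> space \<pi> \<inter> (snd -` B \<inter> space \<pi>) \<in> sets \<pi>"
    by measurable
  have "emeasure \<pi> (S -` A \<inter> space \<pi> \<inter> (snd -` B \<inter> space \<pi>)) =
      (\<integral>\<^sup>+ p. indicator A (S p) * indicator B (snd p) \<partial>\<pi>)"
    unfolding nn_integral_indicator[OF m, symmetric]
    by (intro nn_integral_cong) (simp split: split_indicator)
  also have "\<dots> = (\<integral>\<^sup>+ z. \<integral>\<^sup>+ x. indicator A (S (x, z)) * indicator B z \<partial>\<rho> z \<partial>\<gamma>)"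
    by (subst nn_integral_\<pi>) simp_all
  also have "\<dots> = (\<integral>\<^sup>+ z. emeasure (distr (\<rho> z) X (\<lambda>x. S (x, z))) A * indicator B z \<partial>\<gamma>)"
  proof (rule nn_integral_cong)
    fix z assume "z \<in> space \<gamma>"
    then have z: "z \<in> space Z" by (simp add: space_\<gamma>)
    note [measurable] = section_measurable[OF S z]
    have "emeasure (distr (\<rho> z) X (\<lambda>x. S (x, z))) A = (\<integral>\<^sup>+ x. indicator A (S (x, z)) \<partial>\<rho> z)"
      using nn_integral_distr[of "\<lambda>x. S (x, z)" "\<rho> z" X "indicator A"] by simp
    then show "(\<integral>\<^sup>+ x. indicator A (S (x, z)) * indicator B z \<partial>\<rho> z) =
        emeasure (distr (\<rho> z) X (\<lambda>x. S (x, z))) A * indicator B z"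
      by (simp add: nn_integral_multc)
  qed
  finally show ?thesis .
qed

lemma emeasure_\<gamma>: "B \<in> sets Z \<Longrightarrow> emeasure \<pi> (snd -` B \<inter> space \<pi>) = emeasure \<gamma> B"
  unfolding \<gamma>_eq by (simp add: emeasure_distr snd_measurable_\<pi>)

text \<open>Puts the Monge cost in the form of a barycenter cost, with the couplings carried by the
  graphs of \<open>S (\<cdot>, z)\<close>, so that the two costs can be compared fibre by
  fibre.\<close>

lemma monge_cost_eq:
  assumes c: "(\<lambda>(x, y). c x y) \<in> borel_measurable (X \<Otimes>\<^sub>M X)"
    and S [measurable]: "S \<in> X \<Otimes>\<^sub>M Z \<rightarrow>\<^sub>M X"
  shows "monge_cost c \<pi> S = (\<integral>\<^sup>+ z. \<integral>\<^sup>+ (x, y). ennreal (c x y)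
    \<partial>distr (\<rho> z) (X \<Otimes>\<^sub>M X) (\<lambda>x. (x, S (x, z))) \<partial>\<gamma>)"
proof -
  have ce [measurable]: "(\<lambda>(x, y). ennreal (c x y)) \<in> borel_measurable (X \<Otimes>\<^sub>M X)"
    using measurable_compose[OF c measurable_ennreal] by (simp add: case_prod_unfold)
  have g: "(\<lambda>p. (fst p, S p)) \<in> X \<Otimes>\<^sub>M Z \<rightarrow>\<^sub>M X \<Otimes>\<^sub>M X"
    by measurable
  have f: "(\<lambda>(x, z). ennreal (c x (S (x, z)))) \<in> borel_measurable (X \<Otimes>\<^sub>M Z)"
    using measurable_compose[OF g ce] by (simp add: case_prod_unfold)
  have "monge_cost c \<pi> S = (\<integral>\<^sup>+ z. \<integral>\<^sup>+ x. ennreal (c x (S (x, z))) \<partial>\<rho> z \<partial>\<gamma>)"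
    unfolding monge_cost_def by (simp add: nn_integral_\<pi>[OF f])
  also have "\<dots> = (\<integral>\<^sup>+ z. \<integral>\<^sup>+ (x, y). ennreal (c x y)
    \<partial>distr (\<rho> z) (X \<Otimes>\<^sub>M X) (\<lambda>x. (x, S (x, z))) \<partial>\<gamma>)"
  proof (rule nn_integral_cong)
    fix z assume "z \<in> space \<gamma>"
    then have "(\<lambda>x. (x, S (x, z))) \<in> \<rho> z \<rightarrow>\<^sub>M X \<Otimes>\<^sub>M X"
      using section_measurable[OF g] by (simp add: space_\<gamma>)
    then show "(\<integral>\<^sup>+ x. ennreal (c x (S (x, z))) \<partial>\<rho> z) =
        (\<integral>\<^sup>+ (x, y). ennreal (c x y) \<partial>distr (\<rho> z) (X \<Otimes>\<^sub>M X) (\<lambda>x. (x, S (x, z))))"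
      by (subst nn_integral_distr) (simp_all add: ce)
  qed
  finally show ?thesis .
qed

section \<open>Constant push-forward implies independence\<close>

text \<open>In \<open>emeasure_joint\<close> the factor depending on \<open>A\<close> no longer
  varies with \<open>z\<close> and can be taken out of the integral, which leaves a product.\<close>

lemma constant_pushforward_imp_monge_feasible:
  assumes S: "S \<in> X \<Otimes>\<^sub>M Z \<rightarrow>\<^sub>M X"
    and const: "\<And>z. z \<in> space Z \<Longrightarrow> distr (\<rho> z) X (\<lambda>x. S (x, z)) = \<mu>"
  shows "S \<in> monge_feasible X Z \<pi>"
proof -
  interpret \<pi>: prob_space \<pi> by (rule prob_space_\<pi>)
  interpret \<gamma>: prob_space \<gamma> by (rule prob_space_\<gamma>)
  have S\<pi>: "S \<in> \<pi> \<rightarrow>\<^sub>M X" using S by measurable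
  have joint: "emeasure \<pi> (S -` A \<inter> space \<pi> \<inter> (snd -` B \<inter> space \<pi>)) = emeasure \<mu> A * emeasure \<gamma> B"
    if "A \<in> sets X" "B \<in> sets Z" for A B
  proof -
    have "emeasure \<pi> (S -` A \<inter> space \<pi> \<inter> (snd -` B \<inter> space \<pi>)) =
        (\<integral>\<^sup>+ z. emeasure \<mu> A * indicator B z \<partial>\<gamma>)"
      unfolding emeasure_joint[OF S that] by (intro nn_integral_cong) (simp add: const space_\<gamma>)
    then show ?thesis using that by (simp add: nn_integral_cmult_indicator sets_\<gamma>)
  qed
  \<comment> \<open>The case \<open>B = space Z\<close> of \<open>joint\<close>, where
    \<open>\<gamma>\<close> has total mass 1: \<open>\<mu>\<close> is the law of
    \<open>S\<close>.\<close>
  have law: "emeasure \<pi> (S -` A \<inter> space \<pi>) = emeasure \<mu> A" if A: "A \<in> sets X" for A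
  proof -
    have "snd -` space Z \<inter> space \<pi> = space \<pi>" by (auto simp: space_\<pi>)
    then show ?thesis
      using joint[OF A sets.top] \<gamma>.emeasure_space_1 by (simp add: space_\<gamma> Int_assoc)
  qed
  show ?thesis
    unfolding monge_feasible_def
    by (auto simp: S independent_rv_iff[OF prob_space_\<pi> S\<pi> snd_measurable_\<pi>] measure_def
        joint law emeasure_\<gamma> enn2real_mult)
qed

section \<open>From Monge maps to families of couplings\<close>

text \<open>Independence makes both sides have the same integral over every measurable
  \<open>B\<close>, hence define the same density. The exceptional null set may still depend on
  \<open>A\<close>.\<close>

lemma monge_feasible_AE_eq:
  assumes S: "S \<in> monge_feasible X Z \<pi>" and A: "A \<in> sets X"
  shows "AE z in \<gamma>. emeasure (distr (\<rho> z) X (\<lambda>x. S (x, z))) A = emeasure (distr \<pi> X S) A"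
proof -
  interpret \<pi>: prob_space \<pi> by (rule prob_space_\<pi>)
  interpret \<gamma>: prob_space \<gamma> by (rule prob_space_\<gamma>)
  have [measurable]: "S \<in> X \<Otimes>\<^sub>M Z \<rightarrow>\<^sub>M X" and ind: "independent_rv \<pi> X S Z snd"
    using S by (auto simp: monge_feasible_def)
  have S\<pi>: "S \<in> \<pi> \<rightarrow>\<^sub>M X" by measurable
  let ?f = "\<lambda>z. emeasure (distr (\<rho> z) X (\<lambda>x. S (x, z))) A"
  let ?a = "emeasure (distr \<pi> X S) A"
  have "(\<lambda>z. distr (\<rho> z) X (\<lambda>x. S (x, z))) \<in> \<gamma> \<rightarrow>\<^sub>M prob_algebra X"
    by measurable
  note K = measurable_prob_algebraD[OF this]
  have f: "?f \<in> borel_measurable \<gamma>"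
    by (rule measurable_compose[OF K measurable_emeasure_subprob_algebra[OF A]])
  have "density \<gamma> ?f = density \<gamma> (\<lambda>_. ?a)"
  proof (rule measure_eqI)
    fix B assume "B \<in> sets (density \<gamma> ?f)"
    then have B: "B \<in> sets Z" by (simp add: sets_\<gamma>)
    have "(\<integral>\<^sup>+ z. ?f z * indicator B z \<partial>\<gamma>) =
        emeasure \<pi> (S -` A \<inter> space \<pi> \<inter> (snd -` B \<inter> space \<pi>))"
      by (rule emeasure_joint[symmetric]) (use A B in measurable)
    also have "\<dots> = emeasure \<pi> (S -` A \<inter> space \<pi>) * emeasure \<pi> (snd -` B \<inter> space \<pi>)"
      using ind A B unfolding independent_rv_iff[OF prob_space_\<pi> S\<pi> snd_measurable_\<pi>]
      by (simp add: \<pi>.emeasure_eq_measure ennreal_mult')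
    also have "\<dots> = ?a * emeasure \<gamma> B"
      using A B by (simp add: emeasure_\<gamma> emeasure_distr[OF S\<pi>])
    finally show "emeasure (density \<gamma> ?f) B = emeasure (density \<gamma> (\<lambda>_. ?a)) B"
      using B f by (simp add: emeasure_density sets_\<gamma> nn_integral_cmult_indicator)
  qed simp
  \<comment> \<open>Densities with respect to the sigma-finite \<open>\<gamma>\<close> are unique up
    to null sets.\<close>
  then show ?thesis
    by (intro \<gamma>.density_unique f) auto
qed

text \<open>Independence says nothing about single values of \<open>z\<close>, whereas the marginal
  condition is imposed at each of them. The family is therefore repaired on a null set, which leaves
  the cost unchanged.\<close>

lemma monge_feasible_imp_barycenter_feasible:
  assumes X: "standard_borel X" and c: "(\<lambda>(x, y). c x y) \<in> borel_measurable (X \<Otimes>\<^sub>M X)"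
    and S: "S \<in> monge_feasible X Z \<pi>"
  obtains p where "p \<in> barycenter_feasible X Z \<rho>" "barycenter_cost c \<gamma> p = monge_cost c \<pi> S"
proof -
  have S' [measurable]: "S \<in> X \<Otimes>\<^sub>M Z \<rightarrow>\<^sub>M X"
    using S by (auto simp: monge_feasible_def)
  have S\<pi>: "S \<in> \<pi> \<rightarrow>\<^sub>M X" by measurable
  obtain E where E: "countable E" "Int_stable E" "E \<subseteq> Pow (space X)" "space X \<in> E"
    "sets X = sigma_sets (space X) E"
    using standard_borel_countable_generator[OF X] .
  have E_sets: "A \<in> sets X" if "A \<in> E" for A
    using that E(5) by (auto intro: sigma_sets.Basic)
  define \<mu> where "\<mu> = distr \<pi> X S"
  have \<mu>: "\<mu> \<in> space (prob_algebra X)"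
    unfolding \<mu>_def by (simp add: space_prob_algebra prob_space.prob_space_distr[OF prob_space_\<pi> S\<pi>])
  then have \<mu>_prob: "prob_space \<mu>" and sets_\<mu>: "sets \<mu> = sets X"
    by (auto simp: space_prob_algebra)
  let ?\<nu> = "\<lambda>z. distr (\<rho> z) X (\<lambda>x. S (x, z))"
  have \<nu>: "?\<nu> \<in> Z \<rightarrow>\<^sub>M prob_algebra X"
    by measurable
  \<comment> \<open>The good values of \<open>z\<close>. Testing only the sets in the countable
    \<open>E\<close> makes \<open>G\<close> measurable and of full measure.\<close>
  define G where "G = {z \<in> space Z. \<forall>A\<in>E. emeasure (?\<nu> z) A = emeasure \<mu> A}"
  \<comment> \<open>Agreement on the intersection-stable generator extends to all measurable sets;
    the one-element cover \<open>{space X}\<close> has finite mass.\<close>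
  have \<nu>_eq: "?\<nu> z = \<mu>" if "z \<in> G" for z
  proof (rule measure_eqI_generator_eq_countable[OF E(2,3)])
    have z: "z \<in> space Z" using that by (simp add: G_def)
    show "emeasure (?\<nu> z) a \<noteq> \<infinity>" if "a \<in> {space X}" for a
      using measurable_space[OF \<nu> z]
      by (auto simp: space_prob_algebra prob_space_def finite_measure.emeasure_finite[simplified])
  qed (use that E in \<open>auto simp: G_def sets_\<mu>\<close>)
  have [measurable]: "(\<lambda>z. emeasure (?\<nu> z) A) \<in> borel_measurable Z" if "A \<in> E" for A
    by (rule measurable_compose[OF measurable_prob_algebraD[OF \<nu>]
          measurable_emeasure_subprob_algebra[OF E_sets[OF that]]])
  have G: "G \<in> sets Z"
    unfolding G_def using E(1) by measurable
  have AE_G: "AE z in \<gamma>. z \<in> G"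
  proof -
    \<comment> \<open>Countably many null sets, one for each \<open>A\<close> in \<open>E\<close>,
      are merged into one.\<close>
    have "AE z in \<gamma>. \<forall>A\<in>E. emeasure (?\<nu> z) A = emeasure \<mu> A"
      unfolding \<mu>_def AE_ball_countable[OF E(1)]
      using monge_feasible_AE_eq[OF S E_sets] by blast
    then show ?thesis
      by (auto simp: G_def space_\<gamma> elim!: AE_mp intro!: AE_I2)
  qed
  \<comment> \<open>The product is a convenient default off \<open>G\<close>: it has the required
    marginals for every \<open>z\<close> and depends measurably on \<open>z\<close>.\<close>
  define \<xi> where "\<xi> = (\<lambda>z. if z \<in> G then distr (\<rho> z) (X \<Otimes>\<^sub>M X) (\<lambda>x. (x, S (x, z))) else \<rho> z \<Otimes>\<^sub>M \<mu>)"
  have \<xi>: "\<xi> \<in> Z \<rightarrow>\<^sub>M prob_algebra (X \<Otimes>\<^sub>M X)"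
    unfolding \<xi>_def
  proof (rule measurable_If_set)
    show "(\<lambda>z. distr (\<rho> z) (X \<Otimes>\<^sub>M X) (\<lambda>x. (x, S (x, z)))) \<in> Z \<rightarrow>\<^sub>M prob_algebra (X \<Otimes>\<^sub>M X)"
      by measurable
    show "(\<lambda>z. \<rho> z \<Otimes>\<^sub>M \<mu>) \<in> Z \<rightarrow>\<^sub>M prob_algebra (X \<Otimes>\<^sub>M X)"
      using \<mu> by (intro measurable_pair_prob measurable_const) measurable
    show "G \<inter> space Z \<in> sets Z" using G by simp
  qed
  have coupling: "\<xi> z \<in> couplings (\<rho> z) \<mu>" if z: "z \<in> space Z" for z
  proof -
    interpret R: prob_space "\<rho> z" by (rule \<rho>_prob[OF z])
    interpret M: prob_space \<mu> by (rule \<mu>_prob)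
    note [measurable_cong] = sets_\<rho>[OF z] sets_\<mu>
    note [measurable] = section_measurable[OF S' z]
    \<comment> \<open>\<open>couplings\<close> refers to
      \<open>\<rho> z \<Otimes>\<^sub>M \<mu>\<close>, which has the same measurable sets as
      \<open>X \<Otimes>\<^sub>M X\<close>.\<close>
    have "\<xi> z \<in> space (prob_algebra (\<rho> z \<Otimes>\<^sub>M \<mu>))"
      using measurable_space[OF \<xi> z] sets_pair_measure_cong[OF sets_\<rho>[OF z] sets_\<mu>]
      by (simp add: space_prob_algebra)
    moreover have "distr (\<xi> z) (\<rho> z) fst = \<rho> z \<and> distr (\<xi> z) \<mu> snd = \<mu>"
    proof (cases "z \<in> G")
      case True
      have "distr (\<xi> z) (\<rho> z) fst = distr (\<rho> z) (\<rho> z) (\<lambda>x. x)"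
        using True by (simp add: \<xi>_def distr_distr comp_def)
      moreover have "distr (\<xi> z) \<mu> snd = distr (\<rho> z) \<mu> (\<lambda>x. S (x, z))"
        using True by (simp add: \<xi>_def distr_distr comp_def)
      moreover have "distr (\<rho> z) \<mu> (\<lambda>x. S (x, z)) = ?\<nu> z"
        by (intro distr_cong sets_\<mu>) simp_all
      ultimately show ?thesis
        using \<nu>_eq[OF True] by (simp add: distr_id[unfolded id_def])
    next
      case False
      have "distr (\<rho> z \<Otimes>\<^sub>M \<mu>) \<mu> snd = \<mu>"
      proof (rule measure_eqI)
        fix A assume "A \<in> sets (distr (\<rho> z \<Otimes>\<^sub>M \<mu>) \<mu> snd)"
        then have A: "A \<in> sets \<mu>" by simp
        \<comment> \<open>The cylinder over \<open>A\<close> has product measure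
          \<open>\<mu> A\<close>, because \<open>\<rho> z\<close> has mass 1.\<close>
        have "snd -` A \<inter> space (\<rho> z \<Otimes>\<^sub>M \<mu>) = space (\<rho> z) \<times> A"
          using sets.sets_into_space[OF A] by (auto simp: space_pair_measure)
        then show "emeasure (distr (\<rho> z \<Otimes>\<^sub>M \<mu>) \<mu> snd) A = emeasure \<mu> A"
          using A by (simp add: emeasure_distr M.emeasure_pair_measure_Times R.emeasure_space_1)
      qed simp
      with False show ?thesis
        by (simp add: \<xi>_def M.distr_pair_fst)
    qed
    ultimately show ?thesis by (simp add: couplings_def)
  qed
  show ?thesis
  proof
    show "(\<mu>, \<xi>) \<in> barycenter_feasible X Z \<rho>"
      using \<mu> \<xi> coupling by (simp add: barycenter_feasible_def)
    \<comment> \<open>The integrands agree on \<open>G\<close>, hence almost everywhere.\<close>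
    show "barycenter_cost c \<gamma> (\<mu>, \<xi>) = monge_cost c \<pi> S"
      unfolding monge_cost_eq[OF c S'] barycenter_cost_def
      using AE_G by (auto simp: \<xi>_def intro!: nn_integral_cong_AE elim!: AE_mp)
  qed
qed

end

section \<open>Optimality of the map and equality of the two values\<close>

theorem lemma1:
  fixes X :: "'x measure" and Z :: "'z measure"
    and \<pi> :: "('x \<times> 'z) measure" and \<gamma> :: "'z measure" and \<rho> :: "'z \<Rightarrow> 'x measure"
    and c :: "'x \<Rightarrow> 'x \<Rightarrow> real"
    and \<mu>s :: "'x measure" and \<xi>s :: "'z \<Rightarrow> ('x \<times> 'x) measure"
    and Q :: "'z \<Rightarrow> 'x \<Rightarrow> 'x"
  defines "T \<equiv> (\<lambda>(x, z). Q z x)"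
  assumes "standard_borel X" and "standard_borel Z"
    and "\<pi> \<in> space (prob_algebra (X \<Otimes>\<^sub>M Z))"
    and "\<gamma> = distr \<pi> Z snd"
    and "\<rho> \<in> Z \<rightarrow>\<^sub>M prob_algebra X"
    and "\<pi> = do {z \<leftarrow> \<gamma>; x \<leftarrow> \<rho> z; return (X \<Otimes>\<^sub>M Z) (x, z)}"
    and "(\<lambda>(x, y). c x y) \<in> borel_measurable (X \<Otimes>\<^sub>M X)"
    and "\<And>x y. x \<in> space X \<Longrightarrow> y \<in> space X \<Longrightarrow> 0 \<le> c x y"
    and "is_arg_min (barycenter_cost c \<gamma>) (\<lambda>p. p \<in> barycenter_feasible X Z \<rho>) (\<mu>s, \<xi>s)"
    and "(\<lambda>(x, z). Q z x) \<in> X \<Otimes>\<^sub>M Z \<rightarrow>\<^sub>M X"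
    and "\<And>z. z \<in> space Z \<Longrightarrow>
           \<xi>s z = do {x \<leftarrow> \<rho> z; y \<leftarrow> return X (Q z x); return (X \<Otimes>\<^sub>M X) (x, y)}"
  shows "is_arg_min (monge_cost c \<pi>) (\<lambda>S. S \<in> monge_feasible X Z \<pi>) T
    \<and> (INF S\<in>monge_feasible X Z \<pi>. monge_cost c \<pi> S)
        = (INF p\<in>barycenter_feasible X Z \<rho>. barycenter_cost c \<gamma> p)
    \<and> (\<forall>z\<in>space Z. \<mu>s = distr (\<rho> z) X (\<lambda>x. T (x, z)))"
proof -
  interpret D: disintegration X Z \<pi> \<gamma> \<rho>
    using assms(4-7) by unfold_locales
  note c = assms(8)
  have T: "T \<in> X \<Otimes>\<^sub>M Z \<rightarrow>\<^sub>M X" using assms(11) by (simp add: T_def)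
  have graph: "(\<lambda>p. (fst p, T p)) \<in> X \<Otimes>\<^sub>M Z \<rightarrow>\<^sub>M X \<Otimes>\<^sub>M X"
    using T by measurable
  \<comment> \<open>\<open>is_arg_min\<close> only excludes strictly smaller costs; as
    \<open>ennreal\<close> is linearly ordered, this gives \<open>\<le>\<close>.\<close>
  have feas: "(\<mu>s, \<xi>s) \<in> barycenter_feasible X Z \<rho>"
    and min: "\<And>p. p \<in> barycenter_feasible X Z \<rho> \<Longrightarrow>
      barycenter_cost c \<gamma> (\<mu>s, \<xi>s) \<le> barycenter_cost c \<gamma> p"
    using assms(10) by (auto simp: is_arg_min_linorder)
  have sets_\<mu>s: "sets \<mu>s = sets X"
    using feas by (auto simp: barycenter_feasible_def space_prob_algebra)
  \<comment> \<open>The monad laws for \<open>return\<close> turn the optimal coupling into the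
    push-forward of \<open>\<rho> z\<close> under the graph map of \<open>T (\<cdot>, z)\<close>,
    the form used in \<open>monge_cost_eq\<close>.\<close>
  have \<xi>s_eq: "\<xi>s z = distr (\<rho> z) (X \<Otimes>\<^sub>M X) (\<lambda>x. (x, T (x, z)))" if z: "z \<in> space Z" for z
  proof -
    have ret: "(\<lambda>y. return (X \<Otimes>\<^sub>M X) (x, y)) \<in> X \<rightarrow>\<^sub>M subprob_algebra (X \<Otimes>\<^sub>M X)"
      if "x \<in> space X" for x
      using that by (intro measurable_compose[OF _ return_measurable]) measurable
    have "\<xi>s z = \<rho> z \<bind> (\<lambda>x. return (X \<Otimes>\<^sub>M X) (x, T (x, z)))"
      unfolding assms(12)[OF z] T_def
      using measurable_space[OF T] z
      by (intro bind_cong refl)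
         (auto simp: D.space_\<rho> T_def space_pair_measure intro!: bind_return[OF ret])
    also have "\<dots> = distr (\<rho> z) (X \<Otimes>\<^sub>M X) (\<lambda>x. (x, T (x, z)))"
      using D.section_measurable[OF graph z]
      by (intro bind_return_distr' prob_space.not_empty[OF D.\<rho>_prob[OF z]]) simp
    finally show ?thesis .
  qed
  \<comment> \<open>Compares second marginals: that of \<open>\<xi>s z\<close> is
    \<open>\<mu>s\<close> by feasibility, and the graph form gives the push-forward under
    \<open>T (\<cdot>, z)\<close>.\<close>
  have push: "distr (\<rho> z) X (\<lambda>x. T (x, z)) = \<mu>s" if z: "z \<in> space Z" for z
  proof -
    have "\<mu>s = distr (\<xi>s z) \<mu>s snd"
      using feas z by (auto simp: barycenter_feasible_def couplings_def)
    also have "\<dots> = distr (\<xi>s z) X snd"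
      by (intro distr_cong sets_\<mu>s) simp_all
    also have "\<dots> = distr (\<rho> z) X (\<lambda>x. T (x, z))"
      using D.section_measurable[OF graph z] by (simp add: \<xi>s_eq[OF z] distr_distr comp_def)
    finally show ?thesis by simp
  qed
  have T_feas: "T \<in> monge_feasible X Z \<pi>"
    using D.constant_pushforward_imp_monge_feasible[OF T push] .
  have T_cost: "monge_cost c \<pi> T = barycenter_cost c \<gamma> (\<mu>s, \<xi>s)"
    unfolding D.monge_cost_eq[OF c T] barycenter_cost_def
    by (auto simp: \<xi>s_eq D.space_\<gamma> intro!: nn_integral_cong)
  \<comment> \<open>Each competitor \<open>S\<close> shares its cost with some feasible family of
    couplings, which cannot beat the optimal one, and \<open>T\<close> attains that optimum.\<close>
  have T_min: "monge_cost c \<pi> T \<le> monge_cost c \<pi> S" if "S \<in> monge_feasible X Z \<pi>" for S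
    using D.monge_feasible_imp_barycenter_feasible[OF assms(2) c that] min T_cost by metis
  \<comment> \<open>Both infima are attained, at \<open>T\<close> and at
    \<open>(\<mu>s, \<xi>s)\<close>, so \<open>T_cost\<close> identifies them.\<close>
  have "(INF S\<in>monge_feasible X Z \<pi>. monge_cost c \<pi> S) = monge_cost c \<pi> T"
    using T_feas T_min by (intro antisym INF_lower INF_greatest)
  moreover have "(INF p\<in>barycenter_feasible X Z \<rho>. barycenter_cost c \<gamma> p) =
      barycenter_cost c \<gamma> (\<mu>s, \<xi>s)"
    using feas min by (intro antisym INF_lower INF_greatest)
  ultimately show ?thesis
    using T_feas T_min T_cost push by (simp add: is_arg_min_linorder)
qed

end
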